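(* Let $A=(a_{ij})_{i,j\in I}$ be a generalized Cartan matrix, $\mathfrak g=\mathfrak g_A$ the corresponding Kac-Moody Lie algebra over $\mathbb C$ with Chevalley generators $e_i,f_i$, and let $\mathbf a=(a_i)_{i\in I}\in\mathbb C^I$. Put $u_i:=e_i+a_i[e_i,f_i]-a_i^2f_i\in\mathfrak g$ for $i\in I$. Then for all distinct $i,j\in I$, $$(\mathrm{ad}\,u_i)^{1-a_{ij}}(u_j)=-2\,\delta_{a_{ij},-1}\,a_{ji}\,a_i\,a_j\,u_i .$$
   Context: A generalized Cartan matrix $A=(a_{ij})_{i,j\in I}$ has $a_{ii}=2$, $a_{ij}\in\mathbb Z_{\le 0}$ for $i\ne j$, and $a_{ij}=0$ iff $a_{ji}=0$; it need not be symmetrizable. $\mathfrak g_A$ is the Lie algebra generated by $e_i,f_i$ ($i\in I$), with $h_i:=[e_i,f_i]$, subject to $[h_i,h_j]=0$, $[e_i,f_j]=\delta_{ij}h_i$, $[h_i,e_j]=a_{ij}e_j$, $[h_i,f_j]=-a_{ij}f_j$, and $(\mathrm{ad}\,e_i)^{1-a_{ij}}(e_j)=(\mathrm{ad}\,f_i)^{1-a_{ij}}(f_j)=0$ for $i\ne j$. Entries with two indices $a_{ij}$ are Cartan matrix entries; those with one index $a_i$ are the parameters. The subalgebra $\mathfrak g^{(\mathbf a)}\subset\mathfrak g$ generated by the $u_i$ is called the generalized electrical Lie algebra of type $\mathfrak g$. $\delta_{x,y}$ is the Kronecker delta. *)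

theory Defs
  imports Complex_Main "HOL-Algebra.Algebraic_Closure_Type"
begin

section \<open>Complex Lie algebras\<close>

abbreviation complex_ring :: "complex ring" where
  "complex_ring \<equiv> ring_of_type_algebra"

text \<open>
  A Lie algebra is carried by the record type of HOL-Algebra modules. Its multiplication
  slot holds the Lie bracket; the slot for the unit element is not used.
\<close>

abbreviation lie_bracket :: "(complex, 'b, 'm) module_scheme \<Rightarrow> 'b \<Rightarrow> 'b \<Rightarrow> 'b" where
  "lie_bracket L \<equiv> monoid.mult L"

abbreviation ad :: "(complex, 'b, 'm) module_scheme \<Rightarrow> 'b \<Rightarrow> 'b \<Rightarrow> 'b" where
  "ad L x \<equiv> (\<lambda>y. lie_bracket L x y)"

locale complex_lie_algebra = module complex_ring L for L (structure) +
  assumes bracket_closed: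
      "\<lbrakk>x \<in> carrier L; y \<in> carrier L\<rbrakk> \<Longrightarrow> lie_bracket L x y \<in> carrier L"
    and bracket_add_left:
      "\<lbrakk>x \<in> carrier L; y \<in> carrier L; z \<in> carrier L\<rbrakk> \<Longrightarrow>
       lie_bracket L (x \<oplus>\<^bsub>L\<^esub> y) z = lie_bracket L x z \<oplus>\<^bsub>L\<^esub> lie_bracket L y z"
    and bracket_add_right:
      "\<lbrakk>x \<in> carrier L; y \<in> carrier L; z \<in> carrier L\<rbrakk> \<Longrightarrow>
       lie_bracket L x (y \<oplus>\<^bsub>L\<^esub> z) = lie_bracket L x y \<oplus>\<^bsub>L\<^esub> lie_bracket L x z"
    and bracket_smult_left:
      "\<lbrakk>x \<in> carrier L; y \<in> carrier L\<rbrakk> \<Longrightarrow>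
       lie_bracket L (c \<odot>\<^bsub>L\<^esub> x) y = c \<odot>\<^bsub>L\<^esub> lie_bracket L x y"
    and bracket_smult_right:
      "\<lbrakk>x \<in> carrier L; y \<in> carrier L\<rbrakk> \<Longrightarrow>
       lie_bracket L x (c \<odot>\<^bsub>L\<^esub> y) = c \<odot>\<^bsub>L\<^esub> lie_bracket L x y"
    and bracket_self:
      "x \<in> carrier L \<Longrightarrow> lie_bracket L x x = \<zero>\<^bsub>L\<^esub>"
    and jacobi:
      "\<lbrakk>x \<in> carrier L; y \<in> carrier L; z \<in> carrier L\<rbrakk> \<Longrightarrow>
       lie_bracket L x (lie_bracket L y z)
         \<oplus>\<^bsub>L\<^esub> (lie_bracket L y (lie_bracket L z x)
         \<oplus>\<^bsub>L\<^esub> lie_bracket L z (lie_bracket L x y)) = \<zero>\<^bsub>L\<^esub>"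


section \<open>Lie algebras given by generators and relations\<close>

datatype 'x lie_term =
    Gen 'x
  | Zero
  | Plus "'x lie_term" "'x lie_term"
  | Scale complex "'x lie_term"
  | Br "'x lie_term" "'x lie_term"

text \<open>
  The least congruence on Lie terms that contains the axioms of a complex Lie algebra and
  identifies the two sides of each defining relation \<open>(s, t) \<in> R\<close>.
\<close>

inductive_set lie_eq :: "('x lie_term \<times> 'x lie_term) set \<Rightarrow> ('x lie_term \<times> 'x lie_term) set"
  for R where
  rel: "(s, t) \<in> R \<Longrightarrow> (s, t) \<in> lie_eq R"
| refl: "(t, t) \<in> lie_eq R"
| sym: "(s, t) \<in> lie_eq R \<Longrightarrow> (t, s) \<in> lie_eq R"
| trans: "\<lbrakk>(s, t) \<in> lie_eq R; (t, u) \<in> lie_eq R\<rbrakk> \<Longrightarrow> (s, u) \<in> lie_eq R"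
| Plus_cong: "\<lbrakk>(s, s') \<in> lie_eq R; (t, t') \<in> lie_eq R\<rbrakk> \<Longrightarrow> (Plus s t, Plus s' t') \<in> lie_eq R"
| Scale_cong: "(t, t') \<in> lie_eq R \<Longrightarrow> (Scale c t, Scale c t') \<in> lie_eq R"
| Br_cong: "\<lbrakk>(s, s') \<in> lie_eq R; (t, t') \<in> lie_eq R\<rbrakk> \<Longrightarrow> (Br s t, Br s' t') \<in> lie_eq R"
| Plus_assoc: "(Plus (Plus s t) u, Plus s (Plus t u)) \<in> lie_eq R"
| Plus_comm: "(Plus s t, Plus t s) \<in> lie_eq R"
| Plus_Zero: "(Plus Zero t, t) \<in> lie_eq R"
| Plus_inverse: "(Plus (Scale (-1) t) t, Zero) \<in> lie_eq R"
| Scale_add: "(Scale (c + d) t, Plus (Scale c t) (Scale d t)) \<in> lie_eq R"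
| Scale_Plus: "(Scale c (Plus s t), Plus (Scale c s) (Scale c t)) \<in> lie_eq R"
| Scale_mult: "(Scale (c * d) t, Scale c (Scale d t)) \<in> lie_eq R"
| Scale_one: "(Scale 1 t, t) \<in> lie_eq R"
| Br_Plus_left: "(Br (Plus s t) u, Plus (Br s u) (Br t u)) \<in> lie_eq R"
| Br_Plus_right: "(Br s (Plus t u), Plus (Br s t) (Br s u)) \<in> lie_eq R"
| Br_Scale_left: "(Br (Scale c s) t, Scale c (Br s t)) \<in> lie_eq R"
| Br_Scale_right: "(Br s (Scale c t), Scale c (Br s t)) \<in> lie_eq R"
| Br_self: "(Br t t, Zero) \<in> lie_eq R"
| Br_jacobi: "(Plus (Br s (Br t u)) (Plus (Br t (Br u s)) (Br u (Br s t))), Zero) \<in> lie_eq R"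

definition lie_class :: "('x lie_term \<times> 'x lie_term) set \<Rightarrow> 'x lie_term \<Rightarrow> 'x lie_term set" where
  "lie_class R t = lie_eq R `` {t}"

definition presented_lie_algebra ::
  "('x lie_term \<times> 'x lie_term) set \<Rightarrow> (complex, 'x lie_term set) module" where
  "presented_lie_algebra R =
    \<lparr>carrier = UNIV // lie_eq R,
     monoid.mult = (\<lambda>S T. \<Union>s\<in>S. \<Union>t\<in>T. lie_class R (Br s t)),
     monoid.one = undefined,
     ring.zero = lie_class R Zero,
     ring.add = (\<lambda>S T. \<Union>s\<in>S. \<Union>t\<in>T. lie_class R (Plus s t)),
     module.smult = (\<lambda>c T. \<Union>t\<in>T. lie_class R (Scale c t))\<rparr>"

lemma equiv_lie_eq: "equiv UNIV (lie_eq R)"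
  by (rule equivI) (auto simp: refl_on_def intro: symI transI lie_eq.refl lie_eq.sym lie_eq.trans)

lemma lie_class_eq_iff: "lie_class R s = lie_class R t \<longleftrightarrow> (s, t) \<in> lie_eq R"
  unfolding lie_class_def using eq_equiv_class_iff[OF equiv_lie_eq] by auto

lemma presented_carrier: "carrier (presented_lie_algebra R) = range (lie_class R)"
  by (auto simp: presented_lie_algebra_def quotient_def lie_class_def)

lemma presented_zero: "\<zero>\<^bsub>presented_lie_algebra R\<^esub> = lie_class R Zero"
  by (simp add: presented_lie_algebra_def)

lemma presented_add:
  "lie_class R s \<oplus>\<^bsub>presented_lie_algebra R\<^esub> lie_class R t = lie_class R (Plus s t)"
proof -
  have "congruent2 (lie_eq R) (lie_eq R) (\<lambda>s t. lie_class R (Plus s t))"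
    by (auto simp: congruent2_def lie_class_eq_iff intro: lie_eq.Plus_cong)
  from UN_equiv_class2[OF equiv_lie_eq equiv_lie_eq this] show ?thesis
    by (simp add: presented_lie_algebra_def lie_class_def)
qed

lemma presented_bracket:
  "lie_bracket (presented_lie_algebra R) (lie_class R s) (lie_class R t) = lie_class R (Br s t)"
proof -
  have "congruent2 (lie_eq R) (lie_eq R) (\<lambda>s t. lie_class R (Br s t))"
    by (auto simp: congruent2_def lie_class_eq_iff intro: lie_eq.Br_cong)
  from UN_equiv_class2[OF equiv_lie_eq equiv_lie_eq this] show ?thesis
    by (simp add: presented_lie_algebra_def lie_class_def)
qed

lemma presented_smult:
  "c \<odot>\<^bsub>presented_lie_algebra R\<^esub> lie_class R t = lie_class R (Scale c t)"
proof -
  have "congruent (lie_eq R) (\<lambda>t. lie_class R (Scale c t))"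
    by (auto simp: congruent_def lie_class_eq_iff intro: lie_eq.Scale_cong)
  from UN_equiv_class[OF equiv_lie_eq this] show ?thesis
    by (simp add: presented_lie_algebra_def lie_class_def)
qed

lemma complex_lie_algebra_presented: "complex_lie_algebra (presented_lie_algebra R)"
proof -
  note ops = rangeI presented_carrier presented_zero presented_add presented_bracket presented_smult
  have "abelian_group (presented_lie_algebra R)"
  proof (rule abelian_groupI)
    fix x assume "x \<in> carrier (presented_lie_algebra R)"
    then obtain t where "x = lie_class R t" by (auto simp: ops)
    then show "\<exists>y\<in>carrier (presented_lie_algebra R).
        y \<oplus>\<^bsub>presented_lie_algebra R\<^esub> x = \<zero>\<^bsub>presented_lie_algebra R\<^esub>"
      by (intro bexI[of _ "lie_class R (Scale (-1) t)"])
        (auto simp: ops lie_class_eq_iff del: equalityI intro: lie_eq.intros)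
  qed (auto simp: ops lie_class_eq_iff del: equalityI intro: lie_eq.Plus_assoc lie_eq.Plus_comm lie_eq.Plus_Zero)
  moreover have "cring complex_ring"
    by (rule cring_from_type_algebra)
  ultimately have "module complex_ring (presented_lie_algebra R)"
    by (intro moduleI)
      (auto simp: ops lie_class_eq_iff ring_of_type_algebra_def
        del: equalityI intro: lie_eq.Scale_add lie_eq.Scale_Plus lie_eq.Scale_mult lie_eq.Scale_one)
  then show ?thesis
    by (intro complex_lie_algebra.intro complex_lie_algebra_axioms.intro)
      (auto simp: ops lie_class_eq_iff
        del: equalityI intro: lie_eq.Br_Plus_left lie_eq.Br_Plus_right lie_eq.Br_Scale_left
          lie_eq.Br_Scale_right lie_eq.Br_self lie_eq.Br_jacobi)
qed

primrec lie_eval :: "(complex, 'b, 'm) module_scheme \<Rightarrow> ('x \<Rightarrow> 'b) \<Rightarrow> 'x lie_term \<Rightarrow> 'b" where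
  "lie_eval M \<phi> (Gen x) = \<phi> x"
| "lie_eval M \<phi> Zero = \<zero>\<^bsub>M\<^esub>"
| "lie_eval M \<phi> (Plus s t) = lie_eval M \<phi> s \<oplus>\<^bsub>M\<^esub> lie_eval M \<phi> t"
| "lie_eval M \<phi> (Scale c t) = c \<odot>\<^bsub>M\<^esub> lie_eval M \<phi> t"
| "lie_eval M \<phi> (Br s t) = lie_bracket M (lie_eval M \<phi> s) (lie_eval M \<phi> t)"

text \<open>
  The universal property: a family of elements of a Lie algebra that satisfies the relations
  induces a well-defined map on the presented Lie algebra.
\<close>

lemma lie_eval_respects_lie_eq:
  assumes M: "complex_lie_algebra M"
    and gens: "\<And>x. \<phi> x \<in> carrier M"
    and rels: "\<And>s t. (s, t) \<in> R \<Longrightarrow> lie_eval M \<phi> s = lie_eval M \<phi> t"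
    and eq: "(s, t) \<in> lie_eq R"
  shows "lie_eval M \<phi> s = lie_eval M \<phi> t"
proof -
  interpret complex_lie_algebra M by (rule M)
  have in_UNIV: "c \<in> carrier complex_ring" for c
    by (simp add: ring_of_type_algebra_def)
  have closed: "lie_eval M \<phi> t \<in> carrier M" for t
    by (induction t) (auto simp: gens bracket_closed in_UNIV)
  have ops: "c \<oplus>\<^bsub>complex_ring\<^esub> d = c + d" "c \<otimes>\<^bsub>complex_ring\<^esub> d = c * d"
    "\<one>\<^bsub>complex_ring\<^esub> = 1" "\<zero>\<^bsub>complex_ring\<^esub> = 0" for c d
    by (simp_all add: ring_of_type_algebra_def)
  have inverse: "(-1) \<odot>\<^bsub>M\<^esub> x \<oplus>\<^bsub>M\<^esub> x = \<zero>\<^bsub>M\<^esub>" if "x \<in> carrier M" for x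
    using smult_l_distr[of "-1" 1 x] smult_one[of x] smult_l_null[of x] that in_UNIV
    by (simp add: ops)
  show ?thesis
    using eq
  proof induction
    case (Scale_add c d t)
    then show ?case using smult_l_distr[of c d] closed in_UNIV by (simp add: ops)
  next
    case (Scale_mult c d t)
    then show ?case using smult_assoc1[of c d] closed in_UNIV by (simp add: ops)
  next
    case (Scale_one t)
    then show ?case using smult_one closed by (simp add: ops)
  next
    case (Plus_comm s t)
    then show ?case using closed by (simp add: M.add.m_comm)
  qed (simp_all add: rels closed in_UNIV inverse M.add.m_assoc smult_r_distr bracket_add_left
        bracket_add_right bracket_smult_left bracket_smult_right bracket_self jacobi)
qed


section \<open>Kac--Moody algebras\<close>

definition generalized_cartan_matrix :: "('i \<Rightarrow> 'i \<Rightarrow> int) \<Rightarrow> bool" where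
  "generalized_cartan_matrix A \<longleftrightarrow>
    (\<forall>i. A i i = 2) \<and>
    (\<forall>i j. i \<noteq> j \<longrightarrow> A i j \<le> 0) \<and>
    (\<forall>i j. A i j = 0 \<longleftrightarrow> A j i = 0)"

datatype 'i chevalley = E 'i | F 'i

abbreviation e_term :: "'i \<Rightarrow> 'i chevalley lie_term" where
  "e_term i \<equiv> Gen (E i)"

abbreviation f_term :: "'i \<Rightarrow> 'i chevalley lie_term" where
  "f_term i \<equiv> Gen (F i)"

abbreviation h_term :: "'i \<Rightarrow> 'i chevalley lie_term" where
  "h_term i \<equiv> Br (e_term i) (f_term i)"

text \<open>
  The relation \<open>[e\<^sub>i, f\<^sub>j] = \<delta>\<^sub>i\<^sub>j h\<^sub>i\<close> is listed for \<open>i \<noteq> j\<close> only: the case \<open>i = j\<close> is the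
  definition of \<open>h\<^sub>i\<close>.
\<close>

inductive_set kac_moody_relations ::
  "('i \<Rightarrow> 'i \<Rightarrow> int) \<Rightarrow> ('i chevalley lie_term \<times> 'i chevalley lie_term) set"
  for A where
  hh: "(Br (h_term i) (h_term j), Zero) \<in> kac_moody_relations A"
| ef: "i \<noteq> j \<Longrightarrow> (Br (e_term i) (f_term j), Zero) \<in> kac_moody_relations A"
| he: "(Br (h_term i) (e_term j), Scale (of_int (A i j)) (e_term j)) \<in> kac_moody_relations A"
| hf: "(Br (h_term i) (f_term j), Scale (- of_int (A i j)) (f_term j)) \<in> kac_moody_relations A"
| serre_e: "i \<noteq> j \<Longrightarrow>
    ((Br (e_term i) ^^ nat (1 - A i j)) (e_term j), Zero) \<in> kac_moody_relations A"
| serre_f: "i \<noteq> j \<Longrightarrow>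
    ((Br (f_term i) ^^ nat (1 - A i j)) (f_term j), Zero) \<in> kac_moody_relations A"

definition kac_moody :: "('i \<Rightarrow> 'i \<Rightarrow> int) \<Rightarrow> (complex, 'i chevalley lie_term set) module" where
  "kac_moody A = presented_lie_algebra (kac_moody_relations A)"

definition chevalley_e :: "('i \<Rightarrow> 'i \<Rightarrow> int) \<Rightarrow> 'i \<Rightarrow> 'i chevalley lie_term set" where
  "chevalley_e A i = lie_class (kac_moody_relations A) (e_term i)"

definition chevalley_f :: "('i \<Rightarrow> 'i \<Rightarrow> int) \<Rightarrow> 'i \<Rightarrow> 'i chevalley lie_term set" where
  "chevalley_f A i = lie_class (kac_moody_relations A) (f_term i)"

definition electrical_u ::
  "('i \<Rightarrow> 'i \<Rightarrow> int) \<Rightarrow> ('i \<Rightarrow> complex) \<Rightarrow> 'i \<Rightarrow> 'i chevalley lie_term set" where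
  "electrical_u A a i =
    chevalley_e A i
      \<oplus>\<^bsub>kac_moody A\<^esub> a i \<odot>\<^bsub>kac_moody A\<^esub> lie_bracket (kac_moody A) (chevalley_e A i) (chevalley_f A i)
      \<ominus>\<^bsub>kac_moody A\<^esub> (a i)\<^sup>2 \<odot>\<^bsub>kac_moody A\<^esub> chevalley_f A i"

end

theory Submission
  imports Defs
begin

text \<open>
  The element \<open>u\<^sub>i\<close> is the image of \<open>e\<^sub>i\<close> under \<open>exp (- a\<^sub>i ad f\<^sub>i)\<close>, so it behaves like \<open>e\<^sub>i\<close> in a
  conjugated sl2-triple. With \<open>m = - a\<^sub>i\<^sub>j\<close>, the vectors \<open>e\<^sub>j\<close> and \<open>f\<^sub>j\<close> are a lowest and a
  highest weight vector of modules of dimension at most \<open>m + 1\<close> over the i-th sl2 by the Serre relations,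
  hence \<open>(ad u\<^sub>i)\<^bsup>m+1\<^esup>\<close> kills both. The component \<open>h\<^sub>j\<close> of \<open>u\<^sub>j\<close> lies in a quotient of the
  adjoint module plus a trivial one, where \<open>(ad u\<^sub>i)\<^sup>2 h\<^sub>j = - 2 a\<^sub>j\<^sub>i a\<^sub>i u\<^sub>i\<close> and
  \<open>(ad u\<^sub>i)\<^sup>3 h\<^sub>j = 0\<close>; only \<open>m = 1\<close> contributes, as \<open>a\<^sub>j\<^sub>i = 0\<close> when \<open>m = 0\<close>.
\<close>

section \<open>Calculus of brackets and of powers of \<open>ad\<close>\<close>

context complex_lie_algebra
begin

lemma scalar_in_carrier [simp]: "c \<in> carrier complex_ring"
  by (simp add: ring_of_type_algebra_def)

lemma scalar_ops:
  "c \<oplus>\<^bsub>complex_ring\<^esub> d = c + d" "c \<otimes>\<^bsub>complex_ring\<^esub> d = c * d"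
  "\<one>\<^bsub>complex_ring\<^esub> = 1" "\<zero>\<^bsub>complex_ring\<^esub> = 0"
  by (simp_all add: ring_of_type_algebra_def)

declare bracket_closed [simp]

lemma smult_add: "x \<in> carrier L \<Longrightarrow> c \<odot> x \<oplus> d \<odot> x = (c + d) \<odot> x"
  using smult_l_distr[of c d x] by (simp add: scalar_ops)

lemma smult_smult [simp]: "x \<in> carrier L \<Longrightarrow> c \<odot> (d \<odot> x) = (c * d) \<odot> x"
  using smult_assoc1[of c d x] by (simp add: scalar_ops)

lemma smult_1 [simp]: "x \<in> carrier L \<Longrightarrow> 1 \<odot> x = x"
  using smult_one[of x] by (simp add: scalar_ops)

lemma smult_0 [simp]: "x \<in> carrier L \<Longrightarrow> 0 \<odot> x = \<zero>"
  using smult_l_null[of x] by (simp add: scalar_ops)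

lemma smult_minus_1: "x \<in> carrier L \<Longrightarrow> (- 1) \<odot> x = \<ominus> x"
  using smult_add[of x "-1" 1] by (intro M.minus_equality[symmetric]) auto

lemma diff_eq_smult: "x \<in> carrier L \<Longrightarrow> y \<in> carrier L \<Longrightarrow> x \<ominus> y = x \<oplus> (- 1) \<odot> y"
  by (simp add: smult_minus_1 a_minus_def)

lemma bracket_zero_right [simp]: "x \<in> carrier L \<Longrightarrow> lie_bracket L x \<zero> = \<zero>"
  using bracket_smult_right[of x \<zero> 0] by simp

lemma bracket_zero_left [simp]: "x \<in> carrier L \<Longrightarrow> lie_bracket L \<zero> x = \<zero>"
  using bracket_smult_left[of \<zero> x 0] by simp

lemma bracket_antisym:
  assumes "x \<in> carrier L" "y \<in> carrier L"
  shows "lie_bracket L y x = (- 1) \<odot> lie_bracket L x y"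
proof -
  have "\<zero> = lie_bracket L (x \<oplus> y) (x \<oplus> y)"
    using assms by (simp add: bracket_self)
  also have "\<dots> = lie_bracket L x y \<oplus> lie_bracket L y x"
    using assms by (subst bracket_add_left) (simp_all add: bracket_add_right bracket_self)
  also have "\<dots> = lie_bracket L y x \<oplus> lie_bracket L x y"
    using assms by (simp add: M.add.m_comm)
  finally have "\<ominus> lie_bracket L x y = lie_bracket L y x"
    using assms by (intro M.minus_equality) auto
  then show ?thesis
    using assms by (simp add: smult_minus_1)
qed

text \<open>The Jacobi identity rearranged to say that \<open>ad L x\<close> is a derivation, the
  form suited to commuting \<open>h\<close> or \<open>f\<close> past powers of
  \<open>ad L e\<close>.\<close>

lemma bracket_bracket:
  assumes "x \<in> carrier L" "y \<in> carrier L" "z \<in> carrier L"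
  shows "lie_bracket L x (lie_bracket L y z) =
    lie_bracket L (lie_bracket L x y) z \<oplus> lie_bracket L y (lie_bracket L x z)"
proof -
  have "lie_bracket L x (lie_bracket L y z) =
      \<ominus> (lie_bracket L y (lie_bracket L z x) \<oplus> lie_bracket L z (lie_bracket L x y))"
    using jacobi[OF assms] assms by (intro M.minus_equality[symmetric]) auto
  also have "\<dots> = (- 1) \<odot> lie_bracket L y (lie_bracket L z x)
      \<oplus> (- 1) \<odot> lie_bracket L z (lie_bracket L x y)"
    using assms by (simp add: smult_minus_1[symmetric] smult_r_distr)
  also have "\<dots> = lie_bracket L y (lie_bracket L x z) \<oplus> lie_bracket L (lie_bracket L x y) z"
    using assms bracket_antisym[of x z] bracket_antisym[of "lie_bracket L x y" z]
    by (simp add: bracket_smult_right)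
  finally show ?thesis
    using assms by (simp add: M.add.m_comm)
qed

lemma ad_pow_closed [simp]:
  "x \<in> carrier L \<Longrightarrow> y \<in> carrier L \<Longrightarrow> (ad L x ^^ n) y \<in> carrier L"
  by (induction n) auto

lemma ad_pow_add:
  "x \<in> carrier L \<Longrightarrow> y \<in> carrier L \<Longrightarrow> z \<in> carrier L \<Longrightarrow>
    (ad L x ^^ n) (y \<oplus> z) = (ad L x ^^ n) y \<oplus> (ad L x ^^ n) z"
  by (induction n) (auto simp: bracket_add_right)

lemma ad_pow_smult:
  "x \<in> carrier L \<Longrightarrow> y \<in> carrier L \<Longrightarrow> (ad L x ^^ n) (c \<odot> y) = c \<odot> (ad L x ^^ n) y"
  by (induction n) (auto simp: bracket_smult_right)

lemma ad_smult_pow: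
  "x \<in> carrier L \<Longrightarrow> y \<in> carrier L \<Longrightarrow> (ad L (c \<odot> x) ^^ n) y = c ^ n \<odot> (ad L x ^^ n) y"
  by (induction n) (auto simp: bracket_smult_right bracket_smult_left mult.commute)

lemma ad_pow_zero: "x \<in> carrier L \<Longrightarrow> (ad L x ^^ n) \<zero> = \<zero>"
  by (induction n) auto

section \<open>Spans of finitely many vectors, built up one vector at a time\<close>

primrec span_below :: "(nat \<Rightarrow> 'a) \<Rightarrow> nat \<Rightarrow> 'a set" where
  "span_below x 0 = {\<zero>}"
| "span_below x (Suc r) = {c \<odot> x r \<oplus> y | c y. y \<in> span_below x r}"

context
  fixes x :: "nat \<Rightarrow> 'a"
  assumes x_closed [simp]: "\<And>k. x k \<in> carrier L"
begin

lemma span_below_closed: "z \<in> span_below x r \<Longrightarrow> z \<in> carrier L"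
  by (induction r arbitrary: z) auto

lemma span_below_mono: "z \<in> span_below x r \<Longrightarrow> z \<in> span_below x (Suc r)"
  using span_below_closed[of z r] by (force intro: exI[of _ "0::complex"])

lemma zero_in_span_below: "\<zero> \<in> span_below x r"
  by (induction r) (auto intro: span_below_mono simp del: span_below.simps(2))

lemma span_below_smult: "z \<in> span_below x r \<Longrightarrow> d \<odot> z \<in> span_below x r"
proof (induction r arbitrary: z)
  case (Suc r)
  then obtain c y where z: "z = c \<odot> x r \<oplus> y" and y: "y \<in> span_below x r"
    by auto
  have "d \<odot> z = (d * c) \<odot> x r \<oplus> d \<odot> y"
    using span_below_closed[OF y] by (simp add: z smult_r_distr)
  with Suc.IH[OF y] show ?case by auto
qed simp

lemma span_below_add:
  "z \<in> span_below x r \<Longrightarrow> w \<in> span_below x r \<Longrightarrow> z \<oplus> w \<in> span_below x r"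
proof (induction r arbitrary: z w)
  case (Suc r)
  then obtain c y d u where z: "z = c \<odot> x r \<oplus> y" and y: "y \<in> span_below x r"
    and w: "w = d \<odot> x r \<oplus> u" and u: "u \<in> span_below x r"
    by auto
  have "z \<oplus> w = (c \<odot> x r \<oplus> d \<odot> x r) \<oplus> (y \<oplus> u)"
    using span_below_closed[OF y] span_below_closed[OF u] by (simp add: z w M.add.m_ac)
  also have "\<dots> = (c + d) \<odot> x r \<oplus> (y \<oplus> u)"
    by (simp add: smult_add)
  finally show ?case using Suc.IH[OF y u] by auto
qed simp

lemma in_span_below: "k < r \<Longrightarrow> x k \<in> span_below x r"
proof (induction r)
  case (Suc r)
  show ?case
  proof (cases "k = r")
    case True
    have "x r = 1 \<odot> x r \<oplus> \<zero>" by simp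
    then show ?thesis unfolding True span_below.simps using zero_in_span_below[of r] by blast
  next
    case False
    then show ?thesis using Suc by (auto intro: span_below_mono simp del: span_below.simps(2))
  qed
qed simp

lemma bracket_in_span_below:
  assumes y: "y \<in> carrier L"
  shows "(\<And>k. k < r \<Longrightarrow> lie_bracket L y (x k) \<in> span_below x s) \<Longrightarrow> z \<in> span_below x r
    \<Longrightarrow> lie_bracket L y z \<in> span_below x s"
proof (induction r arbitrary: z)
  case 0
  then show ?case using y by (simp add: zero_in_span_below)
next
  case (Suc r)
  then obtain c u where z: "z = c \<odot> x r \<oplus> u" and u: "u \<in> span_below x r"
    by auto
  have "lie_bracket L y z = c \<odot> lie_bracket L y (x r) \<oplus> lie_bracket L y u"
    using y span_below_closed[OF u] by (simp add: z bracket_add_right bracket_smult_right)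
  moreover have "lie_bracket L y u \<in> span_below x s"
    using Suc u by auto
  ultimately show ?case
    using Suc.prems(1)[of r] by (auto intro: span_below_add span_below_smult)
qed

text \<open>Because \<open>z\<close> has eigenvalue \<open>d\<close>, \<open>(d - c r) z\<close>
  equals \<open>h z - c r z\<close>. The operator \<open>h - c r\<close> kills \<open>x r\<close>,
  so this lies in the span of the earlier vectors. Dividing by \<open>d - c r\<close> and descending
  leaves only zero. The \<open>x k\<close> may vanish or be dependent.\<close>

lemma eigenvector_in_span_below:
  assumes h: "h \<in> carrier L"
    and eig: "\<And>k. lie_bracket L h (x k) = c k \<odot> x k"
    and z: "lie_bracket L h z = d \<odot> z"
  shows "z \<in> span_below x r \<Longrightarrow> (\<And>k. k < r \<Longrightarrow> d \<noteq> c k) \<Longrightarrow> z = \<zero>"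
proof (induction r)
  case (Suc r)
  then obtain b u where zu: "z = b \<odot> x r \<oplus> u" and u: "u \<in> span_below x r"
    by auto
  note u_closed [simp] = span_below_closed[OF u]
  have z_closed [simp]: "z \<in> carrier L" by (simp add: zu)
  have hu: "lie_bracket L h u \<in> span_below x r"
    by (rule bracket_in_span_below[OF h _ u]) (auto simp: eig intro: span_below_smult in_span_below)
  have "(d - c r) \<odot> z = lie_bracket L h z \<oplus> (- c r) \<odot> z"
    by (simp add: z smult_add)
  also have "\<dots> = (b * c r) \<odot> x r \<oplus> (lie_bracket L h u \<oplus> ((- (b * c r)) \<odot> x r \<oplus> (- c r) \<odot> u))"
    using h by (simp add: zu bracket_add_right bracket_smult_right eig smult_r_distr M.add.m_assoc
        mult.commute)
  also have "\<dots> = ((b * c r) \<odot> x r \<oplus> (- (b * c r)) \<odot> x r) \<oplus> (lie_bracket L h u \<oplus> (- c r) \<odot> u)"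
    using h by (simp add: M.add.m_ac)
  also have "\<dots> = lie_bracket L h u \<oplus> (- c r) \<odot> u"
    using h by (simp add: smult_add)
  also have "\<dots> \<in> span_below x r"
    using hu u by (intro span_below_add span_below_smult)
  finally have "inverse (d - c r) \<odot> ((d - c r) \<odot> z) \<in> span_below x r"
    by (rule span_below_smult)
  then have "z \<in> span_below x r"
    using Suc.prems(2)[of r] by simp
  then show ?case using Suc by auto
qed simp

end

section \<open>Triples spanning an image of sl2, and their conjugates\<close>

definition sl2_triple :: "'a \<Rightarrow> 'a \<Rightarrow> 'a \<Rightarrow> bool" where
  "sl2_triple e h f \<longleftrightarrow> e \<in> carrier L \<and> h \<in> carrier L \<and> f \<in> carrier L \<and>
    lie_bracket L e f = h \<and> lie_bracket L h e = 2 \<odot> e \<and> lie_bracket L h f = (- 2) \<odot> f"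

context
  fixes e h f
  assumes sl2: "sl2_triple e h f"
begin

lemma sl2_closed [simp]: "e \<in> carrier L" "h \<in> carrier L" "f \<in> carrier L"
  using sl2 by (auto simp: sl2_triple_def)

lemma sl2_bracket:
  "lie_bracket L e f = h" "lie_bracket L h e = 2 \<odot> e" "lie_bracket L h f = (- 2) \<odot> f"
  "lie_bracket L f e = (- 1) \<odot> h" "lie_bracket L e h = (- 2) \<odot> e" "lie_bracket L f h = 2 \<odot> f"
  using sl2 bracket_antisym[of e f] bracket_antisym[of h e] bracket_antisym[of h f]
  by (auto simp: sl2_triple_def)

definition sl2_comb :: "complex \<Rightarrow> complex \<Rightarrow> complex \<Rightarrow> 'a" where
  "sl2_comb p q r = p \<odot> e \<oplus> (q \<odot> h \<oplus> r \<odot> f)"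

lemma sl2_comb_closed [simp]: "sl2_comb p q r \<in> carrier L"
  by (simp add: sl2_comb_def)

lemma sl2_comb_add:
  "sl2_comb p q r \<oplus> sl2_comb p' q' r' = sl2_comb (p + p') (q + q') (r + r')"
proof -
  have "sl2_comb p q r \<oplus> sl2_comb p' q' r' =
    (p \<odot> e \<oplus> p' \<odot> e) \<oplus> ((q \<odot> h \<oplus> q' \<odot> h) \<oplus> (r \<odot> f \<oplus> r' \<odot> f))"
    by (simp add: sl2_comb_def M.add.m_ac)
  then show ?thesis by (simp add: smult_add sl2_comb_def)
qed

lemma sl2_comb_smult: "c \<odot> sl2_comb p q r = sl2_comb (c * p) (c * q) (c * r)"
  by (simp add: sl2_comb_def smult_r_distr)

text \<open>Puts \<open>f\<close> itself in coordinates, so that \<open>sl2_comb_bracket\<close>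
  also computes brackets with \<open>f\<close>.\<close>

lemma f_eq_sl2_comb: "f = sl2_comb 0 0 1"
  by (simp add: sl2_comb_def)

lemma sl2_comb_bracket:
  "lie_bracket L (sl2_comb p q r) (sl2_comb p' q' r') =
    sl2_comb (2 * (q * p' - p * q')) (p * r' - r * p') (2 * (r * q' - q * r'))"
proof -
  have e: "lie_bracket L e (sl2_comb p' q' r') = sl2_comb (- 2 * q') r' 0"
    by (simp add: sl2_comb_def bracket_add_right bracket_smult_right bracket_self sl2_bracket
        mult.commute)
  have h: "lie_bracket L h (sl2_comb p' q' r') = sl2_comb (2 * p') 0 (- 2 * r')"
    by (simp add: sl2_comb_def bracket_add_right bracket_smult_right bracket_self sl2_bracket
        mult.commute)
  have f: "lie_bracket L f (sl2_comb p' q' r') = sl2_comb 0 (- p') (2 * q')"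
    by (simp add: sl2_comb_def bracket_add_right bracket_smult_right bracket_self sl2_bracket
        mult.commute M.add.m_comm)
  have "lie_bracket L (sl2_comb p q r) (sl2_comb p' q' r') =
      p \<odot> lie_bracket L e (sl2_comb p' q' r') \<oplus> (q \<odot> lie_bracket L h (sl2_comb p' q' r')
      \<oplus> r \<odot> lie_bracket L f (sl2_comb p' q' r'))"
    by (subst (1) sl2_comb_def) (simp add: bracket_add_left bracket_smult_left)
  then show ?thesis
    by (simp add: e h f sl2_comb_smult sl2_comb_add algebra_simps)
qed

text \<open>The automorphism of sl2 exchanging \<open>e\<close> and \<open>f\<close>; it turns
  highest weight vectors into lowest weight vectors.\<close>

lemma sl2_triple_swap: "sl2_triple f ((- 1) \<odot> h) e"
  using sl2 by (auto simp: sl2_triple_def sl2_bracket bracket_smult_left)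

text \<open>The image of the triple under \<open>exp (- a ad f)\<close>.\<close>

lemma sl2_triple_conj: "sl2_triple (sl2_comb 1 a (- a\<^sup>2)) (sl2_comb 0 1 (- 2 * a)) f"
  by (simp add: sl2_triple_def, subst (1 2 3) f_eq_sl2_comb)
    (simp add: sl2_comb_bracket sl2_comb_smult power2_eq_square algebra_simps)

section \<open>Lowest and highest weight vectors\<close>

context
  fixes v \<mu>
  assumes v [simp]: "v \<in> carrier L"
    and hv: "lie_bracket L h v = (- \<mu>) \<odot> v" and fv: "lie_bracket L f v = \<zero>"
begin

lemma h_ad_pow: "lie_bracket L h ((ad L e ^^ n) v) = (2 * of_nat n - \<mu>) \<odot> (ad L e ^^ n) v"
proof (induction n)
  case (Suc n)
  then show ?case
    by (simp add: bracket_bracket[of h e] sl2_bracket bracket_smult_left bracket_smult_right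
        smult_add algebra_simps)
qed (simp add: hv)

text \<open>From \<open>[f, e] = - h\<close>, each further factor \<open>e\<close> adds minus the
  weight of \<open>e^n v\<close>, that is \<open>\<mu> - 2 n\<close>, and these sum to the
  coefficient shown. It vanishes at \<open>n = 0\<close>, where \<open>n - 1\<close> is truncated,
  and at \<open>n = \<mu> + 1\<close>.\<close>

lemma f_ad_pow:
  "lie_bracket L f ((ad L e ^^ n) v) = (of_nat n * (\<mu> - of_nat n + 1)) \<odot> (ad L e ^^ (n - 1)) v"
proof (induction n)
  case (Suc n)
  \<comment> \<open>The case \<open>n = 0\<close> is separate because \<open>n - 1\<close>
    truncates; both coefficients are then 0.\<close>
  have "(of_nat n * (\<mu> - of_nat n + 1)) \<odot> lie_bracket L e ((ad L e ^^ (n - 1)) v) =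
    (of_nat n * (\<mu> - of_nat n + 1)) \<odot> (ad L e ^^ n) v"
    by (cases n) simp_all
  then show ?case
    by (simp add: bracket_bracket[of f e] Suc sl2_bracket bracket_smult_left bracket_smult_right
        h_ad_pow smult_add algebra_simps)
qed (simp add: fv)

end

end

text \<open>
  Let \<open>u = e + a h - a\<^sup>2 f\<close>. The vector \<open>u\<^bsup>m+1\<^esup> v\<close> is killed by \<open>f\<close>, since \<open>u\<close>, \<open>h - 2 a f\<close>, \<open>f\<close> is again
  an sl2-triple; hence it has \<open>h\<close>-weight \<open>m + 2\<close>, which does not occur in the span of the
  vectors \<open>e\<^sup>k v\<close>, \<open>k \<le> m\<close>.
\<close>

lemma conj_ad_pow_eq_zero:
  assumes sl2: "sl2_triple e h f" and v: "v \<in> carrier L"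
    and hv: "lie_bracket L h v = (- of_nat m) \<odot> v" and fv: "lie_bracket L f v = \<zero>"
    and ev: "(ad L e ^^ Suc m) v = \<zero>"
  shows "(ad L (sl2_comb e h f 1 a (- a\<^sup>2)) ^^ Suc m) v = \<zero>"
proof -
  let ?u = "sl2_comb e h f 1 a (- a\<^sup>2)" and ?h = "sl2_comb e h f 0 1 (- 2 * a)"
  let ?x = "\<lambda>k. (ad L e ^^ k) v"
  define z where "z = (ad L ?u ^^ Suc m) v"
  note [simp] = sl2_closed[OF sl2] sl2_comb_closed[OF sl2] v
  note conj = sl2_triple_conj[OF sl2, of a]
  have x_closed [simp]: "?x k \<in> carrier L" for k by simp
  have z_closed [simp]: "z \<in> carrier L" by (simp add: z_def)
  note S = span_below_add[of ?x, OF x_closed] span_below_smult[of ?x, OF x_closed]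
    in_span_below[of ?x, OF x_closed] zero_in_span_below[of ?x, OF x_closed]
  \<comment> \<open>At \<open>k = m\<close> the next vector would leave the span, but it is zero by
    \<open>ev\<close>.\<close>
  have e: "lie_bracket L e (?x k) \<in> span_below ?x (Suc m)" if "k < Suc m" for k
    using ev S(3)[of "Suc k" "Suc m"] S(4)[of "Suc m"] that
    by (cases "k = m") (auto simp del: span_below.simps)
  have ux: "lie_bracket L ?u (?x k) \<in> span_below ?x (Suc m)" if "k < Suc m" for k
  proof -
    have "lie_bracket L ?u (?x k) = lie_bracket L e (?x k) \<oplus>
       (a \<odot> lie_bracket L h (?x k) \<oplus> (- a\<^sup>2) \<odot> lie_bracket L f (?x k))"
      by (simp add: sl2_comb_def[OF sl2] bracket_add_left bracket_smult_left)
    then show ?thesis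
      using that by (simp add: h_ad_pow[OF sl2 v hv fv] f_ad_pow[OF sl2 v hv fv] S e
          del: span_below.simps)
  qed
  have u: "lie_bracket L ?u y \<in> span_below ?x (Suc m)" if "y \<in> span_below ?x (Suc m)" for y
    by (rule bracket_in_span_below[of ?x ?u, OF x_closed sl2_comb_closed[OF sl2] ux that])
  have "(ad L ?u ^^ n) v \<in> span_below ?x (Suc m)" for n
  proof (induction n)
    case 0
    show ?case using S(3)[of 0 "Suc m"] by simp
  next
    case (Suc n)
    then show ?case by (simp only: funpow.simps comp_apply u)
  qed
  then have z_span: "z \<in> span_below ?x (Suc m)" by (simp only: z_def)
  \<comment> \<open>As \<open>f\<close> kills \<open>v\<close>, the vector \<open>v\<close> keeps
    its weight for the conjugated triple, so both weight formulas apply to that triple as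
    well.\<close>
  have h': "lie_bracket L ?h v = (- of_nat m) \<odot> v"
    by (simp add: sl2_comb_def[OF sl2] bracket_add_left bracket_smult_left hv fv)
  \<comment> \<open>The coefficient is \<open>(m + 1) (m - (m + 1) + 1) = 0\<close>.\<close>
  have fz: "lie_bracket L f z = \<zero>"
    unfolding z_def using f_ad_pow[OF conj v h' fv, of "Suc m"] by simp
  \<comment> \<open>\<open>?h\<close> and \<open>h\<close> differ by a multiple of \<open>f\<close>,
    which kills \<open>z\<close>. The weight \<open>m + 2\<close> for \<open>?h\<close> is therefore
    also its weight for \<open>h\<close>.\<close>
  have "lie_bracket L ?h z = lie_bracket L h z"
    by (simp add: sl2_comb_def[OF sl2] bracket_add_left bracket_smult_left fz)
  then have hz: "lie_bracket L h z = (2 * of_nat (Suc m) - of_nat m) \<odot> z"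
    unfolding z_def using h_ad_pow[OF conj v h' fv, of "Suc m"] by simp
  have neq: "2 * of_nat (Suc m) - of_nat m \<noteq> (2 * of_nat k - of_nat m :: complex)"
    if "k < Suc m" for k
    using that by (simp del: of_nat_Suc)
  show ?thesis
    using eigenvector_in_span_below[of ?x, OF x_closed sl2_closed(2)[OF sl2]
        h_ad_pow[OF sl2 v hv fv] hz z_span neq]
    by (simp add: z_def)
qed

text \<open>
  For \<open>a \<noteq> 0\<close>, the element \<open>u\<close> is a multiple of the corresponding element of the triple
  \<open>f\<close>, \<open>- h\<close>, \<open>e\<close> with parameter \<open>1 / a\<close>, for which \<open>v\<close> is a lowest weight vector.
\<close>

lemma conj_ad_pow_eq_zero':
  assumes sl2: "sl2_triple e h f" and v: "v \<in> carrier L"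
    and hv: "lie_bracket L h v = of_nat m \<odot> v" and ev: "lie_bracket L e v = \<zero>"
    and fv: "(ad L f ^^ Suc m) v = \<zero>"
  shows "(ad L (sl2_comb e h f 1 a (- a\<^sup>2)) ^^ Suc m) v = \<zero>"
proof (cases "a = 0")
  case True
  \<comment> \<open>Without a parameter \<open>1 / a\<close> to rescale by, \<open>u\<close> is just
    \<open>e\<close>, which kills \<open>v\<close> by \<open>ev\<close>.\<close>
  have "sl2_comb e h f 1 a (- a\<^sup>2) = e"
    using sl2_closed[OF sl2] by (simp add: True sl2_comb_def[OF sl2])
  then show ?thesis
    using ad_pow_zero[of e m] sl2_closed[OF sl2] ev by (simp add: funpow_swap1)
next
  case False
  let ?u = "sl2_comb f ((- 1) \<odot> h) e 1 (1 / a) (- (1 / a)\<^sup>2)"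
  note swap = sl2_triple_swap[OF sl2]
  have "sl2_comb e h f 1 a (- a\<^sup>2) = (- a\<^sup>2) \<odot> ?u"
    using False sl2_closed[OF sl2]
    by (simp add: sl2_comb_smult[OF swap])
      (simp add: sl2_comb_def[OF sl2] sl2_comb_def[OF swap] M.add.m_ac power2_eq_square)
  moreover have "(ad L ?u ^^ Suc m) v = \<zero>"
    using sl2_closed[OF sl2] v
    by (intro conj_ad_pow_eq_zero swap) (auto simp: bracket_smult_left hv ev fv simp del: funpow.simps)
  ultimately show ?thesis
    using v by (simp add: ad_smult_pow sl2_comb_closed[OF swap] del: funpow.simps)
qed

section \<open>Action on a Cartan element\<close>

lemma conj_ad_cartan:
  assumes sl2: "sl2_triple e h f" and k: "k \<in> carrier L"
    and brackets: "lie_bracket L e k = (- c) \<odot> e" "lie_bracket L h k = \<zero>"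
      "lie_bracket L f k = c \<odot> f"
  shows "lie_bracket L (sl2_comb e h f 1 a (- a\<^sup>2)) k = sl2_comb e h f (- c) 0 (- c * a\<^sup>2)"
  using sl2_closed[OF sl2] k
  by (simp add: sl2_comb_def[OF sl2] bracket_add_left bracket_smult_left brackets mult.commute)

text \<open>The second bracket of \<open>u\<close> with \<open>k\<close> is already a multiple of
  \<open>u\<close>, so the third is zero. Of the exponents \<open>Suc m\<close>, the exponent 1
  gives zero because then \<open>c = 0\<close>, the exponent 2 gives the multiple of
  \<open>u\<close>, and larger ones give zero.\<close>

lemma conj_ad_pow_cartan:
  assumes sl2: "sl2_triple e h f" and k: "k \<in> carrier L"
    and brackets: "lie_bracket L e k = (- c) \<odot> e" "lie_bracket L h k = \<zero>"
      "lie_bracket L f k = c \<odot> f"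
    and c: "m = 0 \<Longrightarrow> c = 0"
  shows "(ad L (sl2_comb e h f 1 a (- a\<^sup>2)) ^^ Suc m) k =
    (if m = 1 then - 2 * c * a else 0) \<odot> sl2_comb e h f 1 a (- a\<^sup>2)"
proof -
  let ?u = "sl2_comb e h f 1 a (- a\<^sup>2)"
  note [simp] = sl2_comb_closed[OF sl2] sl2_closed[OF sl2] k
  note uk = conj_ad_cartan[OF sl2 k brackets, of a]
  have uuk: "lie_bracket L ?u (lie_bracket L ?u k) = (- 2 * c * a) \<odot> ?u"
    unfolding uk sl2_comb_bracket[OF sl2] sl2_comb_smult[OF sl2]
    by (simp add: power2_eq_square algebra_simps)
  consider "m = 0" | "m = 1" | n where "m = Suc (Suc n)"
    by (metis One_nat_def not0_implies_Suc)
  then show ?thesis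
  proof cases
    case 1
    then show ?thesis
      using c by (simp add: uk) (simp add: sl2_comb_def[OF sl2])
  next
    case 2
    then show ?thesis by (simp add: uuk)
  next
    case (3 n)
    \<comment> \<open>The three innermost brackets are split off so that \<open>[u, u] = 0\<close>
      applies.\<close>
    have "(ad L ?u ^^ Suc m) k = (ad L ?u ^^ n) (lie_bracket L ?u (lie_bracket L ?u (lie_bracket L ?u k)))"
      by (simp add: 3 funpow_swap1)
    also have "\<dots> = \<zero>"
      by (simp add: uuk bracket_smult_right bracket_self ad_pow_zero)
    finally show ?thesis by (simp add: 3)
  qed
qed

end

section \<open>Chevalley generators of the Kac-Moody algebra\<close>

lemma complex_lie_algebra_kac_moody: "complex_lie_algebra (kac_moody A)"
  unfolding kac_moody_def by (rule complex_lie_algebra_presented)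

lemma lie_class_Br_pow:
  "lie_class R ((Br s ^^ n) t) = (ad (presented_lie_algebra R) (lie_class R s) ^^ n) (lie_class R t)"
  by (induction n) (simp_all add: presented_bracket[symmetric])

context
  fixes A :: "'i \<Rightarrow> 'i \<Rightarrow> int"
begin

interpretation K: complex_lie_algebra "kac_moody A"
  by (rule complex_lie_algebra_kac_moody)

abbreviation chevalley_h :: "'i \<Rightarrow> 'i chevalley lie_term set" where
  "chevalley_h i \<equiv> lie_bracket (kac_moody A) (chevalley_e A i) (chevalley_f A i)"

lemma chevalley_closed:
  "chevalley_e A i \<in> carrier (kac_moody A)" "chevalley_f A i \<in> carrier (kac_moody A)"
  by (simp_all add: chevalley_e_def chevalley_f_def kac_moody_def presented_carrier)

lemma kac_moody_relation:
  "(s, t) \<in> kac_moody_relations A \<Longrightarrow>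
    lie_class (kac_moody_relations A) s = lie_class (kac_moody_relations A) t"
  by (simp add: lie_class_eq_iff lie_eq.rel)

text \<open>Read back as equations between classes of terms, with \<open>lie_class_Br_pow\<close>
  for the Serre relations, each item is a defining relation.\<close>

lemma chevalley_relations:
  "lie_bracket (kac_moody A) (chevalley_h i) (chevalley_h j) = \<zero>\<^bsub>kac_moody A\<^esub>"
  "i \<noteq> j \<Longrightarrow> lie_bracket (kac_moody A) (chevalley_e A i) (chevalley_f A j) = \<zero>\<^bsub>kac_moody A\<^esub>"
  "lie_bracket (kac_moody A) (chevalley_h i) (chevalley_e A j) =
    of_int (A i j) \<odot>\<^bsub>kac_moody A\<^esub> chevalley_e A j"
  "lie_bracket (kac_moody A) (chevalley_h i) (chevalley_f A j) =
    (- of_int (A i j)) \<odot>\<^bsub>kac_moody A\<^esub> chevalley_f A j"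
  "i \<noteq> j \<Longrightarrow> (ad (kac_moody A) (chevalley_e A i) ^^ nat (1 - A i j)) (chevalley_e A j) =
    \<zero>\<^bsub>kac_moody A\<^esub>"
  "i \<noteq> j \<Longrightarrow> (ad (kac_moody A) (chevalley_f A i) ^^ nat (1 - A i j)) (chevalley_f A j) =
    \<zero>\<^bsub>kac_moody A\<^esub>"
  unfolding kac_moody_def chevalley_e_def chevalley_f_def
    lie_class_Br_pow[symmetric] presented_bracket presented_smult presented_zero
  by (rule kac_moody_relation, rule kac_moody_relations.intros, assumption?)+

lemma chevalley_sl2_triple:
  assumes "A i i = 2"
  shows "K.sl2_triple (chevalley_e A i) (chevalley_h i) (chevalley_f A i)"
  unfolding K.sl2_triple_def
  using chevalley_relations(3,4)[of i i]
  by (intro conjI chevalley_closed K.bracket_closed refl) (simp_all add: assms)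

lemma electrical_u_eq_comb:
  assumes "A i i = 2"
  shows "electrical_u A a i =
    K.sl2_comb (chevalley_e A i) (chevalley_h i) (chevalley_f A i) 1 (a i) (- (a i)\<^sup>2)"
  by (simp add: electrical_u_def K.sl2_comb_def[OF chevalley_sl2_triple[OF assms]]
      K.diff_eq_smult chevalley_closed K.M.add.m_assoc)

end

theorem theorem1p2:
  fixes A :: "'i \<Rightarrow> 'i \<Rightarrow> int" and a :: "'i \<Rightarrow> complex" and i j :: 'i
  assumes "generalized_cartan_matrix A" and "i \<noteq> j"
  shows "(ad (kac_moody A) (electrical_u A a i) ^^ nat (1 - A i j)) (electrical_u A a j) =
    (- 2 * (if A i j = - 1 then 1 else 0) * of_int (A j i) * a i * a j)
      \<odot>\<^bsub>kac_moody A\<^esub> electrical_u A a i"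
proof -
  interpret K: complex_lie_algebra "kac_moody A"
    by (rule complex_lie_algebra_kac_moody)
  let ?K = "kac_moody A" and ?e = "chevalley_e A" and ?f = "chevalley_f A"
  \<comment> \<open>\<open>m\<close> is the weight parameter of the string lemmas, and the exponent
    \<open>1 - A i j\<close> becomes \<open>Suc m\<close>.\<close>
  define m where "m = nat (- A i j)"
  have "A i j \<le> 0" and "A i j = 0 \<longleftrightarrow> A j i = 0" and diag: "A i i = 2" "A j j = 2"
    using assms by (auto simp: generalized_cartan_matrix_def)
  then have Aij: "A i j = - int m" and zero: "m = 0 \<Longrightarrow> A j i = 0"
    by (auto simp: m_def)
  have n: "nat (1 - A i j) = Suc m"
    by (simp add: Aij)
  note [simp] = chevalley_closed
  note sl2 = chevalley_sl2_triple[of A, OF diag(1)]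
  define u where "u = K.sl2_comb (?e i) (chevalley_h A i) (?f i) 1 (a i) (- (a i)\<^sup>2)"
  have u_closed [simp]: "u \<in> carrier ?K"
    unfolding u_def by (rule K.sl2_comb_closed[OF sl2])
  note rel = chevalley_relations[where A = A]
  note serre = rel(5,6)[OF \<open>i \<noteq> j\<close>, unfolded n]
  \<comment> \<open>\<open>e_j\<close> is a lowest weight vector of weight \<open>- m\<close>:
    \<open>[f_i, e_j] = 0\<close> is \<open>[e_j, f_i] = 0\<close> with the sign reversed.\<close>
  have ue: "(ad ?K u ^^ Suc m) (?e j) = \<zero>\<^bsub>?K\<^esub>"
    unfolding u_def
    using rel(2)[OF \<open>i \<noteq> j\<close>[symmetric]] K.bracket_antisym[of "?e j" "?f i"]
    by (intro K.conj_ad_pow_eq_zero sl2 serre) (simp_all add: rel Aij)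
  \<comment> \<open>Dually, \<open>f_j\<close> is a highest weight vector of weight
    \<open>m\<close>.\<close>
  have uf: "(ad ?K u ^^ Suc m) (?f j) = \<zero>\<^bsub>?K\<^esub>"
    unfolding u_def using \<open>i \<noteq> j\<close>
    by (intro K.conj_ad_pow_eq_zero' sl2 serre) (simp_all add: rel Aij)
  \<comment> \<open>Here \<open>c = A j i\<close>, with the indices in this order, since
    \<open>[h_j, e_i] = A j i e_i\<close>; it vanishes for \<open>m = 0\<close> by
    \<open>zero\<close>.\<close>
  have uh: "(ad ?K u ^^ Suc m) (chevalley_h A j) =
      (if m = 1 then - 2 * of_int (A j i) * a i else 0) \<odot>\<^bsub>?K\<^esub> u"
    unfolding u_def
    using K.bracket_antisym[of "chevalley_h A j" "?e i"] K.bracket_antisym[of "chevalley_h A j" "?f i"]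
    by (intro K.conj_ad_pow_cartan sl2) (simp_all add: rel zero)
  have m1: "A i j = - 1 \<longleftrightarrow> m = 1"
    by (auto simp: Aij)
  \<comment> \<open>Of the three components of \<open>u_j\<close>, only the one along
    \<open>h_j\<close> survives; its coefficient supplies the factor \<open>a j\<close>.\<close>
  have "(ad ?K u ^^ Suc m) (electrical_u A a j) = a j \<odot>\<^bsub>?K\<^esub> (ad ?K u ^^ Suc m) (chevalley_h A j)"
    by (simp add: electrical_u_def K.diff_eq_smult K.ad_pow_add K.ad_pow_smult ue uf
        del: funpow.simps)
  then show ?thesis
    by (simp add: n electrical_u_eq_comb[of A, OF diag(1)] u_def[symmetric] uh m1 mult_ac
        del: funpow.simps)
qed

end
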